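(* Let $M$ be a smooth manifold with metric $\bar g$, and let $\bar\nabla$ be an affine connection (covariant derivative) on $TM$ satisfying $\bar\nabla\bar g=0$. Let $P$ be an admissible dilation--shear deformation field over $(M,\bar g)$, and define the induced metric $g$ by $$g(U,V)=\bar g(PU,PV),\qquad\text{equivalently } g=P^T\bar gP .$$ Define the deformed-space covariant derivative by $$\nabla_XV=P^{-1}\bar\nabla_X(PV)$$ for vector fields $X,V$. Then $\nabla$ is metric-compatible with the induced metric $g$, that is, $$\nabla g=0 .$$ Consequently, the nonmetricity tensor $Q(X;U,V):=-(\nabla_Xg)(U,V)$ of $\nabla$ with respect to $g$ vanishes identically.
   Context: $M$ is a smooth $n$-dimensional manifold. The reference metric $\bar g$ is a Riemannian or pseudo-Riemannian metric. A deformation field $P$ is a smooth, pointwise invertible $(1,1)$-tensor field, i.e. a smooth bundle automorphism of $TM$ covering the identity. When $\bar g$ is positive-definite, $P$ is called an admissible (pure dilation--shear) deformation field over $(M,\bar g)$ if it is $\bar g$-self-adjoint, $\bar g(PX,Y)=\bar g(X,PY)$ for all $X,Y$ (written $P^T\bar g=\bar gP$), and positive-definite. In indefinite signature no further explicit pointwise condition beyond invertibility is specified: the class of admissible fields (the restricted non-rotational, dilation--shear sector) is part of the given data. The notation $P^T\bar gP$ denotes the bilinear form $(U,V)\mapsto\bar g(PU,PV)$. The connection $\bar\nabla$ is not assumed torsion-free. As usual $(\nabla_Xg)(U,V)=X[g(U,V)]-g(\nabla_XU,V)-g(U,\nabla_XV)$. *)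

theory Defs
  imports "HOL-Analysis.Analysis"
begin

section \<open>Smooth manifolds\<close>

text \<open>The class C^k on an open subset of a finite-dimensional space: all directional derivatives
  of order at most k exist and are continuous, and the derivatives of order less than k are
  Frechet differentiable.\<close>

primrec Ck_on :: "nat \<Rightarrow> 'e::euclidean_space set \<Rightarrow> ('e \<Rightarrow> 'f::real_normed_vector) \<Rightarrow> bool" where
  "Ck_on 0 S f \<longleftrightarrow> continuous_on S f"
| "Ck_on (Suc k) S f \<longleftrightarrow>
     (\<forall>x\<in>S. f differentiable (at x)) \<and> (\<forall>v. Ck_on k S (\<lambda>x. frechet_derivative f (at x) v))"

definition smooth_on :: "'e::euclidean_space set \<Rightarrow> ('e \<Rightarrow> 'f::real_normed_vector) \<Rightarrow> bool" where
  "smooth_on S f \<longleftrightarrow> (\<forall>k. Ck_on k S f)"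

text \<open>The points of the manifold are the elements of the Hausdorff, second countable type
  \<open>'a\<close>; its dimension is \<open>DIM('e)\<close>. A chart is a pair of an open domain and a coordinate map,
  which is only meaningful on the domain. The smooth structure is given by an
  atlas, which need not be maximal.\<close>

type_synonym ('a, 'e) chart = "'a set \<times> ('a \<Rightarrow> 'e)"

definition is_chart :: "('a::topological_space, 'e::euclidean_space) chart \<Rightarrow> bool" where
  "is_chart = (\<lambda>(U, \<phi>). open U \<and> open (\<phi> ` U) \<and> homeomorphism U (\<phi> ` U) \<phi> (inv_into U \<phi>))"

definition smooth_atlas ::
    "('a::{t2_space, second_countable_topology}, 'e::euclidean_space) chart set \<Rightarrow> bool" where
  "smooth_atlas A \<longleftrightarrow>
     (\<forall>c\<in>A. is_chart c) \<and> (\<Union>(U, \<phi>)\<in>A. U) = UNIV \<and>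
     (\<forall>(U, \<phi>)\<in>A. \<forall>(V, \<psi>)\<in>A. smooth_on (\<phi> ` (U \<inter> V)) (\<psi> \<circ> inv_into U \<phi>))"

definition smooth_funs ::
    "('a::topological_space, 'e::euclidean_space) chart set \<Rightarrow> ('a \<Rightarrow> real) set" where
  "smooth_funs A = {f. \<forall>(U, \<phi>)\<in>A. smooth_on (\<phi> ` U) (f \<circ> inv_into U \<phi>)}"


section \<open>Tangent vectors and vector fields\<close>

text \<open>Tangent vectors at a point are the derivations of the algebra of smooth functions at that
  point. They are made total by the value 0 on non-smooth functions, so that equality of tangent
  vectors is equality of HOL functions.\<close>

type_synonym 'a tvec = "('a \<Rightarrow> real) \<Rightarrow> real"

definition tzero :: "'a tvec" where
  "tzero = (\<lambda>f. 0)"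

definition tadd :: "'a tvec \<Rightarrow> 'a tvec \<Rightarrow> 'a tvec" where
  "tadd u v = (\<lambda>f. u f + v f)"

definition tscale :: "real \<Rightarrow> 'a tvec \<Rightarrow> 'a tvec" where
  "tscale c u = (\<lambda>f. c * u f)"

definition tangent_space ::
    "('a::topological_space, 'e::euclidean_space) chart set \<Rightarrow> 'a \<Rightarrow> 'a tvec set" where
  "tangent_space A p = {u.
     (\<forall>f. f \<notin> smooth_funs A \<longrightarrow> u f = 0) \<and>
     (\<forall>f\<in>smooth_funs A. \<forall>h\<in>smooth_funs A. u (\<lambda>x. f x + h x) = u f + u h) \<and>
     (\<forall>c. \<forall>f\<in>smooth_funs A. u (\<lambda>x. c * f x) = c * u f) \<and>
     (\<forall>f\<in>smooth_funs A. \<forall>h\<in>smooth_funs A. u (\<lambda>x. f x * h x) = f p * u h + h p * u f)}"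

type_synonym 'a vfield = "'a \<Rightarrow> 'a tvec"

definition vf_apply :: "'a vfield \<Rightarrow> ('a \<Rightarrow> real) \<Rightarrow> 'a \<Rightarrow> real" where
  "vf_apply X f = (\<lambda>p. X p f)"

definition vf_add :: "'a vfield \<Rightarrow> 'a vfield \<Rightarrow> 'a vfield" where
  "vf_add X Y = (\<lambda>p. tadd (X p) (Y p))"

definition vf_scale :: "('a \<Rightarrow> real) \<Rightarrow> 'a vfield \<Rightarrow> 'a vfield" where
  "vf_scale f X = (\<lambda>p. tscale (f p) (X p))"

definition vfields ::
    "('a::topological_space, 'e::euclidean_space) chart set \<Rightarrow> 'a vfield set" where
  "vfields A = {X. (\<forall>p. X p \<in> tangent_space A p) \<and>
                   (\<forall>f\<in>smooth_funs A. vf_apply X f \<in> smooth_funs A)}"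


section \<open>Metrics and connections\<close>

text \<open>Tensor fields are families of multilinear maps on the tangent spaces; only their values on
  tangent vectors matter. Such a family is smooth iff it maps smooth vector fields to smooth
  functions (or smooth vector fields).\<close>

type_synonym 'a bform = "'a \<Rightarrow> 'a tvec \<Rightarrow> 'a tvec \<Rightarrow> real"

definition bf_eval :: "'a bform \<Rightarrow> 'a vfield \<Rightarrow> 'a vfield \<Rightarrow> 'a \<Rightarrow> real" where
  "bf_eval g U V = (\<lambda>p. g p (U p) (V p))"

text \<open>Riemannian or pseudo-Riemannian metrics, of arbitrary signature.\<close>

definition pseudo_metric ::
    "('a::topological_space, 'e::euclidean_space) chart set \<Rightarrow> 'a bform \<Rightarrow> bool" where
  "pseudo_metric A g \<longleftrightarrow>
     (\<forall>p. \<forall>u\<in>tangent_space A p. \<forall>v\<in>tangent_space A p. g p u v = g p v u) \<and>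
     (\<forall>p. \<forall>u\<in>tangent_space A p. \<forall>v\<in>tangent_space A p. \<forall>w\<in>tangent_space A p.
        g p (tadd u v) w = g p u w + g p v w) \<and>
     (\<forall>p c. \<forall>u\<in>tangent_space A p. \<forall>v\<in>tangent_space A p. g p (tscale c u) v = c * g p u v) \<and>
     (\<forall>p. \<forall>u\<in>tangent_space A p. (\<forall>v\<in>tangent_space A p. g p u v = 0) \<longrightarrow> u = tzero) \<and>
     (\<forall>X\<in>vfields A. \<forall>Y\<in>vfields A. bf_eval g X Y \<in> smooth_funs A)"

definition positive_definite ::
    "('a::topological_space, 'e::euclidean_space) chart set \<Rightarrow> 'a bform \<Rightarrow> bool" where
  "positive_definite A g \<longleftrightarrow> (\<forall>p. \<forall>u\<in>tangent_space A p. u \<noteq> tzero \<longrightarrow> g p u u > 0)"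

type_synonym 'a connection = "'a vfield \<Rightarrow> 'a vfield \<Rightarrow> 'a vfield"

definition affine_connection ::
    "('a::topological_space, 'e::euclidean_space) chart set \<Rightarrow> 'a connection \<Rightarrow> bool" where
  "affine_connection A D \<longleftrightarrow>
     (\<forall>X\<in>vfields A. \<forall>V\<in>vfields A. D X V \<in> vfields A) \<and>
     (\<forall>X\<in>vfields A. \<forall>Y\<in>vfields A. \<forall>V\<in>vfields A. D (vf_add X Y) V = vf_add (D X V) (D Y V)) \<and>
     (\<forall>f\<in>smooth_funs A. \<forall>X\<in>vfields A. \<forall>V\<in>vfields A. D (vf_scale f X) V = vf_scale f (D X V)) \<and>
     (\<forall>X\<in>vfields A. \<forall>V\<in>vfields A. \<forall>W\<in>vfields A. D X (vf_add V W) = vf_add (D X V) (D X W)) \<and>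
     (\<forall>c. \<forall>X\<in>vfields A. \<forall>V\<in>vfields A. D X (vf_scale (\<lambda>_. c) V) = vf_scale (\<lambda>_. c) (D X V)) \<and>
     (\<forall>f\<in>smooth_funs A. \<forall>X\<in>vfields A. \<forall>V\<in>vfields A.
        D X (vf_scale f V) = vf_add (vf_scale (vf_apply X f) V) (vf_scale f (D X V)))"

text \<open>\<open>cov_deriv_metric D g X U V\<close> is the function \<open>(D\<^sub>X g)(U, V)\<close>.\<close>

definition cov_deriv_metric ::
    "'a connection \<Rightarrow> 'a bform \<Rightarrow> 'a vfield \<Rightarrow> 'a vfield \<Rightarrow> 'a vfield \<Rightarrow> 'a \<Rightarrow> real" where
  "cov_deriv_metric D g X U V =
     (\<lambda>p. vf_apply X (bf_eval g U V) p - bf_eval g (D X U) V p - bf_eval g U (D X V) p)"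

definition metric_compatible ::
    "('a::topological_space, 'e::euclidean_space) chart set \<Rightarrow> 'a connection \<Rightarrow> 'a bform \<Rightarrow> bool" where
  "metric_compatible A D g \<longleftrightarrow>
     (\<forall>X\<in>vfields A. \<forall>U\<in>vfields A. \<forall>V\<in>vfields A. \<forall>p. cov_deriv_metric D g X U V p = 0)"

definition nonmetricity ::
    "'a connection \<Rightarrow> 'a bform \<Rightarrow> 'a vfield \<Rightarrow> 'a vfield \<Rightarrow> 'a vfield \<Rightarrow> 'a \<Rightarrow> real" where
  "nonmetricity D g X U V = (\<lambda>p. - cov_deriv_metric D g X U V p)"


section \<open>Deformation fields\<close>

type_synonym 'a endo = "'a \<Rightarrow> 'a tvec \<Rightarrow> 'a tvec"

definition endo_apply :: "'a endo \<Rightarrow> 'a vfield \<Rightarrow> 'a vfield" where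
  "endo_apply P X = (\<lambda>p. P p (X p))"

definition endo_inverse ::
    "('a::topological_space, 'e::euclidean_space) chart set \<Rightarrow> 'a endo \<Rightarrow> 'a endo" where
  "endo_inverse A P = (\<lambda>p. the_inv_into (tangent_space A p) (P p))"

definition tensor_field_1_1 ::
    "('a::topological_space, 'e::euclidean_space) chart set \<Rightarrow> 'a endo \<Rightarrow> bool" where
  "tensor_field_1_1 A P \<longleftrightarrow>
     (\<forall>p. \<forall>u\<in>tangent_space A p. P p u \<in> tangent_space A p) \<and>
     (\<forall>p. \<forall>u\<in>tangent_space A p. \<forall>v\<in>tangent_space A p. P p (tadd u v) = tadd (P p u) (P p v)) \<and>
     (\<forall>p c. \<forall>u\<in>tangent_space A p. P p (tscale c u) = tscale c (P p u)) \<and>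
     (\<forall>X\<in>vfields A. endo_apply P X \<in> vfields A)"

definition deformation_field ::
    "('a::topological_space, 'e::euclidean_space) chart set \<Rightarrow> 'a endo \<Rightarrow> bool" where
  "deformation_field A P \<longleftrightarrow>
     tensor_field_1_1 A P \<and> (\<forall>p. bij_betw (P p) (tangent_space A p) (tangent_space A p))"

definition self_adjoint ::
    "('a::topological_space, 'e::euclidean_space) chart set \<Rightarrow> 'a bform \<Rightarrow> 'a endo \<Rightarrow> bool" where
  "self_adjoint A g P \<longleftrightarrow>
     (\<forall>p. \<forall>u\<in>tangent_space A p. \<forall>v\<in>tangent_space A p. g p (P p u) v = g p u (P p v))"

definition positive_endo ::
    "('a::topological_space, 'e::euclidean_space) chart set \<Rightarrow> 'a bform \<Rightarrow> 'a endo \<Rightarrow> bool" where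
  "positive_endo A g P \<longleftrightarrow> (\<forall>p. \<forall>u\<in>tangent_space A p. u \<noteq> tzero \<longrightarrow> g p (P p u) u > 0)"

text \<open>The class of admissible (dilation--shear) fields over \<open>(M, g)\<close>: determined by self-adjointness
  and positivity when \<open>g\<close> is Riemannian, and otherwise an arbitrary given class of
  deformation fields.\<close>

definition admissible_class ::
    "('a::topological_space, 'e::euclidean_space) chart set \<Rightarrow> 'a bform \<Rightarrow> 'a endo set \<Rightarrow> bool" where
  "admissible_class A g Adm \<longleftrightarrow>
     (\<forall>P\<in>Adm. deformation_field A P) \<and>
     (positive_definite A g \<longrightarrow>
        Adm = {P. deformation_field A P \<and> self_adjoint A g P \<and> positive_endo A g P})"

definition induced_metric :: "'a bform \<Rightarrow> 'a endo \<Rightarrow> 'a bform" where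
  "induced_metric g P = (\<lambda>p u v. g p (P p u) (P p v))"

definition deformed_connection ::
    "('a::topological_space, 'e::euclidean_space) chart set \<Rightarrow> 'a endo \<Rightarrow> 'a connection \<Rightarrow> 'a connection" where
  "deformed_connection A P D = (\<lambda>X V. endo_apply (endo_inverse A P) (D X (endo_apply P V)))"

end

theory Submission
  imports Defs
begin

text \<open>The field \<open>P\<close> carries the deformed geometry to the reference one:
  \<open>g\<close> is the pullback of \<open>gbar\<close> under \<open>P\<close>, and the deformed
  connection is the conjugate of \<open>Dbar\<close> by \<open>P\<close>, so applying
  \<open>P\<close> to its value on \<open>X\<close>, \<open>V\<close> gives
  \<open>Dbar X (P V)\<close>. Hence the covariant derivative of \<open>g\<close> on
  \<open>U\<close>, \<open>V\<close> is that of \<open>gbar\<close> on \<open>P U\<close>,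
  \<open>P V\<close> (\<open>cov_deriv_induced_metric\<close>), which vanishes.\<close>

lemma endo_apply_vfields:
  assumes "deformation_field A P" "V \<in> vfields A"
  shows "endo_apply P V \<in> vfields A"
  using assms by (simp add: deformation_field_def tensor_field_1_1_def)

text \<open>Cancels \<open>P\<close> against its inverse. As \<open>the_inv_into\<close> inverts
  \<open>P p\<close> only on the tangent space, \<open>D X (P V)\<close> must first be seen to take
  tangent values.\<close>

lemma endo_apply_deformed_connection:
  assumes P: "deformation_field A P" and D: "affine_connection A D"
    and X: "X \<in> vfields A" and V: "V \<in> vfields A"
  shows "endo_apply P (deformed_connection A P D X V) = D X (endo_apply P V)"
proof
  fix p
  have "D X (endo_apply P V) \<in> vfields A"
    using D X endo_apply_vfields[OF P V] by (simp add: affine_connection_def)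
  then have "D X (endo_apply P V) p \<in> tangent_space A p"
    by (simp add: vfields_def)
  moreover have "bij_betw (P p) (tangent_space A p) (tangent_space A p)"
    using P by (simp add: deformation_field_def)
  ultimately show "endo_apply P (deformed_connection A P D X V) p = D X (endo_apply P V) p"
    by (simp add: deformed_connection_def endo_apply_def endo_inverse_def
        f_the_inv_into_f_bij_betw)
qed

lemma bf_eval_induced_metric:
  "bf_eval (induced_metric g P) U V = bf_eval g (endo_apply P U) (endo_apply P V)"
  by (simp add: bf_eval_def induced_metric_def endo_apply_def)

text \<open>The terms agree one by one: the derivative term by the pullback identity, the two others
  by that identity and the intertwining. The direction \<open>X\<close> is not moved by
  \<open>P\<close>.\<close>

lemma cov_deriv_induced_metric:
  assumes "deformation_field A P" "affine_connection A D"
    and "X \<in> vfields A" "U \<in> vfields A" "V \<in> vfields A"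
  shows "cov_deriv_metric (deformed_connection A P D) (induced_metric g P) X U V =
    cov_deriv_metric D g X (endo_apply P U) (endo_apply P V)"
  using assms
  by (simp add: cov_deriv_metric_def bf_eval_induced_metric endo_apply_deformed_connection)

theorem theorem4p1:
  fixes A :: "('a::{t2_space, second_countable_topology}, 'e::euclidean_space) chart set"
    and gbar :: "'a bform"
    and Dbar :: "'a connection"
    and Adm :: "'a endo set"
    and P :: "'a endo"
  assumes "smooth_atlas A"
    and "pseudo_metric A gbar"
    and "affine_connection A Dbar"
    and "metric_compatible A Dbar gbar"
    and "admissible_class A gbar Adm"
    and "P \<in> Adm"
  shows "metric_compatible A (deformed_connection A P Dbar) (induced_metric gbar P) \<and>
    (\<forall>X\<in>vfields A. \<forall>U\<in>vfields A. \<forall>V\<in>vfields A. \<forall>p.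
       nonmetricity (deformed_connection A P Dbar) (induced_metric gbar P) X U V p = 0)"
proof -
  have P: "deformation_field A P"
    using assms(5,6) by (simp add: admissible_class_def)
  \<comment> \<open>Compatibility of \<open>Dbar\<close> with \<open>gbar\<close> is applied to
    \<open>P U\<close> and \<open>P V\<close>, which are again smooth fields.\<close>
  have "metric_compatible A (deformed_connection A P Dbar) (induced_metric gbar P)"
    using assms(4) endo_apply_vfields[OF P]
    by (simp add: metric_compatible_def cov_deriv_induced_metric[OF P assms(3)])
  then show ?thesis
    by (simp add: metric_compatible_def nonmetricity_def)
qed

end
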